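(* Let $\boldsymbol{\pi}$ be the closed-loop RNN system described in the context, let $\mathcal{X}\subset\mathbb{R}^n$ be any hybrid zonotope (HZ), let $T>1$, and let $\{\mathcal{S}_{x,t}\}_{t=2}^T$ be the state-pair sets over the domain $\mathcal{X}$ computed by the exact algorithm described in the context. (i) For any initial set $\mathcal{X}_1\subseteq\mathcal{X}$ represented by an HZ and every $t=2,\dots,T$, the $t$-step forward reachable set $\mathcal{R}_t(\mathcal{X}_1)$ can be represented by the following HZ: $$\mathcal{R}_t(\mathcal{X}_1)=[\mathbf{0}_{n\times n}\;\;\boldsymbol{I}_n]\cdot\big(\mathcal{S}_{x,t}\cap_{[\boldsymbol{I}_n\;\mathbf{0}_{n\times n}]}\mathcal{X}_1\big).$$ (ii) For any target set $\mathcal{T}$ represented by an HZ and every $t=2,\dots,T$, the $t$-step backward reachable set $\mathcal{P}_t(\mathcal{T})$ in the domain $\mathcal{X}$ can be represented by the following HZ: $$\mathcal{P}_t(\mathcal{T})=[\boldsymbol{I}_n\;\;\mathbf{0}_{n\times n}]\cdot\big(\mathcal{S}_{x,t}\cap_{[\mathbf{0}_{n\times n}\;\boldsymbol{I}_n]}\mathcal{T}\big).$$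
   Context: **Hybrid zonotopes.** A set $\mathcal{Z}\subset\mathbb{R}^n$ is a hybrid zonotope (HZ) if there are $\mathbf{c}\in\mathbb{R}^n$, $\mathbf{G}^c\in\mathbb{R}^{n\times n_g}$, $\mathbf{G}^b\in\mathbb{R}^{n\times n_b}$, $\mathbf{A}^c\in\mathbb{R}^{n_c\times n_g}$, $\mathbf{A}^b\in\mathbb{R}^{n_c\times n_b}$, $\mathbf{b}\in\mathbb{R}^{n_c}$ with $\mathcal{Z}=\{\mathbf{G}^c\xi^c+\mathbf{G}^b\xi^b+\mathbf{c}\mid \|\xi^c\|_\infty\le1,\ \xi^b\in\{-1,1\}^{n_b},\ \mathbf{A}^c\xi^c+\mathbf{A}^b\xi^b=\mathbf{b}\}$; write $\mathcal{Z}=\langle\mathbf{G}^c,\mathbf{G}^b,\mathbf{c},\mathbf{A}^c,\mathbf{A}^b,\mathbf{b}\rangle$ (numbers of generators or constraints may be $0$). The algorithm operates on such representations. Operations: - Affine map: $R\mathcal{Z}+v=\langle R\mathbf{G}^c,R\mathbf{G}^b,R\mathbf{c}+v,\mathbf{A}^c,\mathbf{A}^b,\mathbf{b}\rangle$. Cartesian products use block-diagonal matrices. - Generalized intersection: $\mathcal{Z}\cap_R\mathcal{Y}=\{z\in\mathcal{Z}\mid Rz\in\mathcal{Y}\}$, represented by $$\left\langle[\mathbf{0}\ \mathbf{G}_z^c],[\mathbf{0}\ \mathbf{G}_z^b],\mathbf{c}_z,\begin{bmatrix}\mathbf{A}_y^c&\mathbf{0}\\\mathbf{0}&\mathbf{A}_z^c\\-\mathbf{G}_y^c&R\mathbf{G}_z^c\end{bmatrix},\begin{bmatrix}\mathbf{A}_y^b&\mathbf{0}\\\mathbf{0}&\mathbf{A}_z^b\\-\mathbf{G}_y^b&R\mathbf{G}_z^b\end{bmatrix},\begin{bmatrix}\mathbf{b}_y\\\mathbf{b}_z\\\mathbf{c}_y-R\mathbf{c}_z\end{bmatrix}\right\rangle.$$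 - Constrained product: if $\mathbf{A}^c_y=\begin{bmatrix}\mathbf{A}^c_z\ \ \mathbf{0}\\\bar{\mathbf{A}}^c_y\end{bmatrix}$, $\mathbf{A}^b_y=\begin{bmatrix}\mathbf{A}^b_z\ \ \mathbf{0}\\\bar{\mathbf{A}}^b_y\end{bmatrix}$, $\mathbf{b}_y=\begin{bmatrix}\mathbf{b}_z\\\bar{\mathbf{b}}_y\end{bmatrix}$ (top block rows $[\mathbf{A}_z\ \mathbf{0}]$), then $$\mathcal{C}(\mathcal{Z},\mathcal{Y})=\left\langle\begin{bmatrix}\mathbf{G}^c_z\ \ \mathbf{0}\\\mathbf{G}^c_y\end{bmatrix},\begin{bmatrix}\mathbf{G}^b_z\ \ \mathbf{0}\\\mathbf{G}^b_y\end{bmatrix},\begin{bmatrix}\mathbf{c}_z\\\mathbf{c}_y\end{bmatrix},\mathbf{A}^c_y,\mathbf{A}^b_y,\mathbf{b}_y\right\rangle.$$ **Closed-loop RNN.** $\boldsymbol{\pi}$ has $L$ hidden layers with weights $W_h^{(\ell)}\in\mathbb{R}^{n_\ell\times n_\ell}$, $W_x^{(\ell)}\in\mathbb{R}^{n_\ell\times n_{\ell-1}}$, $v_h^{(\ell)}\in\mathbb{R}^{n_\ell}$ ($\ell\in[L]=\{1,\dots,L\}$, $n_0=n$), output weights $W_y\in\mathbb{R}^{n\times n_L}$, $v_y\in\mathbb{R}^n$, and $\sigma$ the componentwise ReLU. From $x_1\in\mathcal{X}$ and zero initial hidden states $h_0^{(\ell)}=0$: $h_t^{(0)}=x_t$,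 $h_t^{(\ell)}=\sigma(W_h^{(\ell)}h_{t-1}^{(\ell)}+W_x^{(\ell)}h_t^{(\ell-1)}+v_h^{(\ell)})$ for $\ell\in[L]$, and $x_{t+1}=\sigma(W_yh_t^{(L)}+v_y)$. This is abbreviated $x_{t+1}=\boldsymbol{\pi}(x_t)$ (hidden states are carried along); $\mathcal{X}$ is the state domain. **Reachable sets.** $\mathcal{R}_t(\mathcal{X}_1)=\{x_t\mid x_1\in\mathcal{X}_1,\ x_{k+1}=\boldsymbol{\pi}(x_k),\ k\in[t-1]\}$ and $\mathcal{P}_t(\mathcal{T})=\{x_1\in\mathcal{X}\mid x_t\in\mathcal{T},\ x_{k+1}=\boldsymbol{\pi}(x_k),\ k\in[t-1]\}$. **ReLU graph.** For an interval $[\alpha,\beta]$, $\mathcal{G}_{ReLU}([\alpha,\beta])$ denotes an HZ exactly representing $\{(s,\max(s,0))\mid s\in[\alpha,\beta]\}$: a segment with one continuous generator if $\alpha\ge0$ or $\beta\le0$, and a fixed HZ $\mathcal{H}_\pm$ with one binary generator if $\alpha<0<\beta$. For a box $\mathcal{I}$, $\mathcal{G}_{ReLU}(\mathcal{I})$ is the Cartesian product over coordinates, and $P$ is the permutation matrix listing all input coordinates first, then all output coordinates. **Exact algorithm.** Input: HZ $\mathcal{X}$, the RNN, $T>1$. Set $\mathcal{H}_1^{(0)}=\mathcal{X}$. For $t=1,\dots,T-1$: for $\ell=1,\dots,L$: let $\mathcal{Z}=W_x^{(\ell)}\mathcal{H}_1^{(\ell-1)}+v_h^{(\ell)}$ if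 $t=1$, and $\mathcal{Z}=[W_h^{(\ell)}\ W_x^{(\ell)}]\,\mathcal{C}(\mathcal{H}_{t-1}^{(\ell)},\mathcal{H}_t^{(\ell-1)})+v_h^{(\ell)}$ if $t\ge2$; let $\mathcal{I}$ be the interval hull of $\mathcal{Z}$ (or a sound box enclosure of it); set $\mathcal{H}_t^{(\ell)}=[\mathbf{0}\ \boldsymbol{I}]\big((P\,\mathcal{G}_{ReLU}(\mathcal{I}))\cap_{[\boldsymbol{I}\ \mathbf{0}]}\mathcal{Z}\big)$. Then with $\mathcal{Z}_y=W_y\mathcal{H}_t^{(L)}+v_y$ and $\mathcal{I}_y$ its interval hull (or a sound box enclosure), set $\mathcal{H}_{t+1}^{(0)}=[\mathbf{0}\ \boldsymbol{I}]\big((P\,\mathcal{G}_{ReLU}(\mathcal{I}_y))\cap_{[\boldsymbol{I}\ \mathbf{0}]}\mathcal{Z}_y\big)$ and $\mathcal{S}_{x,t+1}=\mathcal{C}(\mathcal{H}_1^{(0)},\mathcal{H}_{t+1}^{(0)})$. Output: $\{\mathcal{S}_{x,t}\}_{t=2}^T$. *)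

theory Defs
  imports Complex_Main "Jordan_Normal_Form.Matrix"
begin

text \<open>Horizontal concatenation \<open>[A B]\<close>; the counterpart of \<^const>\<open>append_rows\<close>.\<close>

definition append_cols :: "'a::zero mat \<Rightarrow> 'a mat \<Rightarrow> 'a mat" (infixr "@\<^sub>c" 66) where
  "A @\<^sub>c B = four_block_mat A B (0\<^sub>m 0 (dim_col A)) (0\<^sub>m 0 (dim_col B))"

definition block_diag :: "'a::zero mat \<Rightarrow> 'a mat \<Rightarrow> 'a mat" where
  "block_diag A B =
     four_block_mat A (0\<^sub>m (dim_row A) (dim_col B)) (0\<^sub>m (dim_row B) (dim_col A)) B"

datatype hz = HZ
  (Gc: "real mat") (Gb: "real mat") (ctr: "real vec")
  (Ac: "real mat") (Ab: "real mat") (bvec: "real vec")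

definition hz_carrier :: "nat \<Rightarrow> hz set" where
  "hz_carrier n = {Z. \<exists>ng nb nc.
     Gc Z \<in> carrier_mat n ng \<and> Gb Z \<in> carrier_mat n nb \<and> ctr Z \<in> carrier_vec n \<and>
     Ac Z \<in> carrier_mat nc ng \<and> Ab Z \<in> carrier_mat nc nb \<and> bvec Z \<in> carrier_vec nc}"

definition hz_set :: "hz \<Rightarrow> real vec set" where
  "hz_set Z = {Gc Z *\<^sub>v \<xi>c + Gb Z *\<^sub>v \<xi>b + ctr Z | \<xi>c \<xi>b.
     \<xi>c \<in> carrier_vec (dim_col (Gc Z)) \<and> (\<forall>i < dim_col (Gc Z). \<bar>\<xi>c $ i\<bar> \<le> 1) \<and>
     \<xi>b \<in> carrier_vec (dim_col (Gb Z)) \<and> (\<forall>i < dim_col (Gb Z). \<xi>b $ i \<in> {-1, 1}) \<and>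
     Ac Z *\<^sub>v \<xi>c + Ab Z *\<^sub>v \<xi>b = bvec Z}"

definition hz_affine :: "real mat \<Rightarrow> hz \<Rightarrow> real vec \<Rightarrow> hz" where
  "hz_affine R Z v = HZ (R * Gc Z) (R * Gb Z) (R *\<^sub>v ctr Z + v) (Ac Z) (Ab Z) (bvec Z)"

abbreviation hz_linear :: "real mat \<Rightarrow> hz \<Rightarrow> hz" where
  "hz_linear R Z \<equiv> hz_affine R Z (0\<^sub>v (dim_row R))"

definition hz_prod :: "hz \<Rightarrow> hz \<Rightarrow> hz" where
  "hz_prod Z Y = HZ (block_diag (Gc Z) (Gc Y)) (block_diag (Gb Z) (Gb Y)) (ctr Z @\<^sub>v ctr Y)
     (block_diag (Ac Z) (Ac Y)) (block_diag (Ab Z) (Ab Y)) (bvec Z @\<^sub>v bvec Y)"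

text \<open>The one-point hybrid zonotope of dimension 0, the empty Cartesian product.\<close>

definition hz_unit :: hz where
  "hz_unit = HZ (0\<^sub>m 0 0) (0\<^sub>m 0 0) (0\<^sub>v 0) (0\<^sub>m 0 0) (0\<^sub>m 0 0) (0\<^sub>v 0)"

text \<open>\<open>hz_inter R Z Y\<close> represents \<open>{z \<in> Z. R z \<in> Y}\<close>. The generators of \<open>Y\<close> come first.\<close>

definition hz_inter :: "real mat \<Rightarrow> hz \<Rightarrow> hz \<Rightarrow> hz" where
  "hz_inter R Z Y = HZ
     (0\<^sub>m (dim_row (Gc Z)) (dim_col (Gc Y)) @\<^sub>c Gc Z)
     (0\<^sub>m (dim_row (Gb Z)) (dim_col (Gb Y)) @\<^sub>c Gb Z)
     (ctr Z)
     (block_diag (Ac Y) (Ac Z) @\<^sub>r ((- Gc Y) @\<^sub>c (R * Gc Z)))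
     (block_diag (Ab Y) (Ab Z) @\<^sub>r ((- Gb Y) @\<^sub>c (R * Gb Z)))
     (bvec Y @\<^sub>v bvec Z @\<^sub>v (ctr Y - R *\<^sub>v ctr Z))"

text \<open>The constraints of \<open>Y\<close> have those of \<open>Z\<close>, padded by zero columns, as top block rows.\<close>

definition hz_extends :: "hz \<Rightarrow> hz \<Rightarrow> bool" where
  "hz_extends Z Y \<longleftrightarrow> (\<exists>kc kb Ac' Ab' b'.
     Ac Y = (Ac Z @\<^sub>c 0\<^sub>m (dim_row (Ac Z)) kc) @\<^sub>r Ac' \<and>
     Ab Y = (Ab Z @\<^sub>c 0\<^sub>m (dim_row (Ab Z)) kb) @\<^sub>r Ab' \<and>
     bvec Y = bvec Z @\<^sub>v b')"

text \<open>The constrained product is defined only under the side condition; elsewhere it is left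
  unspecified, so nothing can be concluded from an application outside its domain.\<close>

definition hz_cprod :: "hz \<Rightarrow> hz \<Rightarrow> hz" where
  "hz_cprod Z Y = (if hz_extends Z Y then HZ
     ((Gc Z @\<^sub>c 0\<^sub>m (dim_row (Gc Z)) (dim_col (Gc Y) - dim_col (Gc Z))) @\<^sub>r Gc Y)
     ((Gb Z @\<^sub>c 0\<^sub>m (dim_row (Gb Z)) (dim_col (Gb Y) - dim_col (Gb Z))) @\<^sub>r Gb Y)
     (ctr Z @\<^sub>v ctr Y) (Ac Y) (Ab Y) (bvec Y)
   else undefined)"

text \<open>Layers are numbered from 1 to \<open>layers\<close>; \<open>width 0\<close> is the state dimension.\<close>

datatype rnn = RNN
  (layers: nat) (width: "nat \<Rightarrow> nat")
  (Wh: "nat \<Rightarrow> real mat") (Wx: "nat \<Rightarrow> real mat") (vh: "nat \<Rightarrow> real vec")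
  (Wy: "real mat") (vy: "real vec")

definition rnn_wf :: "nat \<Rightarrow> rnn \<Rightarrow> bool" where
  "rnn_wf n N \<longleftrightarrow> width N 0 = n \<and>
     (\<forall>l \<in> {1..layers N}.
        Wh N l \<in> carrier_mat (width N l) (width N l) \<and>
        Wx N l \<in> carrier_mat (width N l) (width N (l - 1)) \<and>
        vh N l \<in> carrier_vec (width N l)) \<and>
     Wy N \<in> carrier_mat n (width N (layers N)) \<and> vy N \<in> carrier_vec n"

definition relu :: "real vec \<Rightarrow> real vec" where
  "relu v = map_vec (\<lambda>s. max s 0) v"

text \<open>\<open>rnn_state N x t l\<close> is \<open>h\<^sub>t\<^sup>l\<close> on the trajectory with \<open>x\<^sub>1 = x\<close>; in particular
  \<open>rnn_state N x t 0\<close> is \<open>x\<^sub>t\<close> for \<open>t \<ge> 1\<close>. Time 0 carries the zero initial hidden states.\<close>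

fun rnn_state :: "rnn \<Rightarrow> real vec \<Rightarrow> nat \<Rightarrow> nat \<Rightarrow> real vec" where
  "rnn_state N x 0 l = 0\<^sub>v (width N l)"
| "rnn_state N x (Suc 0) 0 = x"
| "rnn_state N x (Suc (Suc t)) 0 =
     relu (Wy N *\<^sub>v rnn_state N x (Suc t) (layers N) + vy N)"
| "rnn_state N x (Suc t) (Suc l) =
     relu (Wh N (Suc l) *\<^sub>v rnn_state N x t (Suc l)
         + Wx N (Suc l) *\<^sub>v rnn_state N x (Suc t) l + vh N (Suc l))"

definition forward_reach :: "rnn \<Rightarrow> nat \<Rightarrow> real vec set \<Rightarrow> real vec set" where
  "forward_reach N t X1 = {rnn_state N x t 0 | x. x \<in> X1}"

definition backward_reach :: "rnn \<Rightarrow> real vec set \<Rightarrow> nat \<Rightarrow> real vec set \<Rightarrow> real vec set" where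
  "backward_reach N X t Tg = {x \<in> X. rnn_state N x t 0 \<in> Tg}"

text \<open>On an interval containing 0 in its interior, any exact representation with one binary
  generator is admitted; the continuous generators and the constraints are left open.\<close>

definition relu_graph_hz :: "(real \<Rightarrow> real \<Rightarrow> hz) \<Rightarrow> bool" where
  "relu_graph_hz G \<longleftrightarrow> (\<forall>\<alpha> \<beta>. \<alpha> \<le> \<beta> \<longrightarrow>
     G \<alpha> \<beta> \<in> hz_carrier 2 \<and>
     hz_set (G \<alpha> \<beta>) = {vec_of_list [s, max s 0] | s. \<alpha> \<le> s \<and> s \<le> \<beta>} \<and>
     (if 0 \<le> \<alpha> \<or> \<beta> \<le> 0
      then dim_col (Gc (G \<alpha> \<beta>)) = 1 \<and> dim_col (Gb (G \<alpha> \<beta>)) = 0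
      else dim_col (Gb (G \<alpha> \<beta>)) = 1))"

text \<open>A box is given by the vectors of its lower and of its upper bounds.\<close>

definition relu_graph_box :: "(real \<Rightarrow> real \<Rightarrow> hz) \<Rightarrow> real vec \<times> real vec \<Rightarrow> hz" where
  "relu_graph_box G I =
     foldr hz_prod (map (\<lambda>i. G (fst I $ i) (snd I $ i)) [0..<dim_vec (fst I)]) hz_unit"

text \<open>The product lists the coordinates as input 0, output 0, input 1, output 1, and so on.\<close>

definition io_perm :: "nat \<Rightarrow> real mat" where
  "io_perm m = mat (2 * m) (2 * m) (\<lambda>(i, j).
     if i < m then (if j = 2 * i then 1 else 0) else (if j = 2 * (i - m) + 1 then 1 else 0))"

definition box_enclosure :: "nat \<Rightarrow> real vec set \<Rightarrow> real vec \<times> real vec \<Rightarrow> bool" where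
  "box_enclosure m Z I \<longleftrightarrow>
     fst I \<in> carrier_vec m \<and> snd I \<in> carrier_vec m \<and> (\<forall>i < m. fst I $ i \<le> snd I $ i) \<and>
     (\<forall>z \<in> Z. \<forall>i < m. fst I $ i \<le> z $ i \<and> z $ i \<le> snd I $ i)"

text \<open>\<open>first_block m\<close> is \<open>[I 0]\<close> and \<open>second_block m\<close> is \<open>[0 I]\<close>, with square blocks of size \<open>m\<close>.\<close>

definition first_block :: "nat \<Rightarrow> real mat" where
  "first_block m = 1\<^sub>m m @\<^sub>c 0\<^sub>m m m"

definition second_block :: "nat \<Rightarrow> real mat" where
  "second_block m = 0\<^sub>m m m @\<^sub>c 1\<^sub>m m"

definition relu_hz :: "(real \<Rightarrow> real \<Rightarrow> hz) \<Rightarrow> real vec \<times> real vec \<Rightarrow> hz \<Rightarrow> hz" where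
  "relu_hz G I Z = (let m = dim_vec (ctr Z) in
     hz_linear (second_block m)
       (hz_inter (first_block m) (hz_linear (io_perm m) (relu_graph_box G I)) Z))"

text \<open>The procedure \<open>B\<close> chooses the boxes: \<open>B t l Z\<close> encloses the argument \<open>Z\<close> of the ReLU step that
  yields the set of index \<open>(t, l)\<close>. The interval hull and coarser sound boxes are both allowed,
  and the choice may differ from step to step.\<close>

definition sound_boxes :: "(nat \<Rightarrow> nat \<Rightarrow> hz \<Rightarrow> real vec \<times> real vec) \<Rightarrow> bool" where
  "sound_boxes B \<longleftrightarrow>
     (\<forall>t l m. \<forall>Z \<in> hz_carrier m. box_enclosure m (hz_set Z) (B t l Z))"

text \<open>\<open>layer_hz G B N X t l\<close> is the set of index \<open>(t, l)\<close> for \<open>t \<ge> 1\<close>; there is none for \<open>t = 0\<close>.\<close>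

fun layer_hz :: "(real \<Rightarrow> real \<Rightarrow> hz) \<Rightarrow> (nat \<Rightarrow> nat \<Rightarrow> hz \<Rightarrow> real vec \<times> real vec) \<Rightarrow>
    rnn \<Rightarrow> hz \<Rightarrow> nat \<Rightarrow> nat \<Rightarrow> hz" where
  "layer_hz G B N X 0 l = undefined"
| "layer_hz G B N X (Suc 0) 0 = X"
| "layer_hz G B N X (Suc (Suc t)) 0 =
     (let Z = hz_affine (Wy N) (layer_hz G B N X (Suc t) (layers N)) (vy N)
      in relu_hz G (B (Suc (Suc t)) 0 Z) Z)"
| "layer_hz G B N X (Suc 0) (Suc l) =
     (let Z = hz_affine (Wx N (Suc l)) (layer_hz G B N X (Suc 0) l) (vh N (Suc l))
      in relu_hz G (B (Suc 0) (Suc l) Z) Z)"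
| "layer_hz G B N X (Suc (Suc t)) (Suc l) =
     (let Z = hz_affine (Wh N (Suc l) @\<^sub>c Wx N (Suc l))
                (hz_cprod (layer_hz G B N X (Suc t) (Suc l)) (layer_hz G B N X (Suc (Suc t)) l))
                (vh N (Suc l))
      in relu_hz G (B (Suc (Suc t)) (Suc l) Z) Z)"

definition state_pair_hz :: "(real \<Rightarrow> real \<Rightarrow> hz) \<Rightarrow>
    (nat \<Rightarrow> nat \<Rightarrow> hz \<Rightarrow> real vec \<times> real vec) \<Rightarrow> rnn \<Rightarrow> hz \<Rightarrow> nat \<Rightarrow> hz" where
  "state_pair_hz G B N X t = hz_cprod (layer_hz G B N X 1 0) (layer_hz G B N X t 0)"

end

theory Submission
  imports Defs
begin

text \<open>Every set computed by the algorithm inherits the constraints of all earlier ones as top block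
  rows, so a feasible pair of factors restricts to a feasible pair for each of them. Conversely a
  ReLU step extends every feasible pair: the box encloses the argument, so the ReLU graph over the
  box has a point above each argument. Hence by induction, in the order in which the sets are
  computed, the factors of the set of index \<open>(t, l)\<close> evaluate in that set to the hidden state
  of the trajectory whose starting point they evaluate to in \<open>X\<close>. The state-pair set is therefore
  the graph of \<open>x \<mapsto> x\<^sub>t\<close> over the domain, and both claims are a restriction followed by a
  projection.\<close>

text \<open>With the dimension equations as rewrite rules for membership in the carriers, the
  library's converse simplification rules would loop.\<close>

declare carrier_vecD [simp del] carrier_matD [simp del] carrier_dim_vec [simp]

lemma carrier_mat_iff [simp]: "A \<in> carrier_mat m k \<longleftrightarrow> dim_row A = m \<and> dim_col A = k"
  by (auto simp: carrier_mat_def)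

text \<open>Factors are modelled as infinite sequences of which a hybrid zonotope reads an initial
  segment. Restricting them to fewer generators then needs no operation at all, and a single pair
  of factors can be fed to all the sets that the algorithm computes.\<close>

definition mat_apply :: "real mat \<Rightarrow> (nat \<Rightarrow> real) \<Rightarrow> real vec" where
  "mat_apply A f = A *\<^sub>v vec (dim_col A) f"

definition shift :: "nat \<Rightarrow> (nat \<Rightarrow> real) \<Rightarrow> nat \<Rightarrow> real" where
  "shift k f = (\<lambda>i. f (k + i))"

definition glue :: "nat \<Rightarrow> (nat \<Rightarrow> real) \<Rightarrow> (nat \<Rightarrow> real) \<Rightarrow> nat \<Rightarrow> real" where
  "glue k f g = (\<lambda>i. if i < k then f i else g (i - k))"

lemma shift_glue [simp]: "shift k (glue k f g) = g"
  by (auto simp: shift_def glue_def)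

lemma glue_less [simp]: "i < k \<Longrightarrow> glue k f g i = f i"
  by (simp add: glue_def)

section \<open>Block matrices acting on factor sequences\<close>

lemma dim_append_cols [simp]:
  "dim_row (A @\<^sub>c B) = dim_row A" "dim_col (A @\<^sub>c B) = dim_col A + dim_col B"
  by (simp_all add: append_cols_def)

lemma dim_append_rows [simp]:
  "dim_row (A @\<^sub>r B) = dim_row A + dim_row B" "dim_col (A @\<^sub>r B) = dim_col A"
  by (simp_all add: append_rows_def)

lemma dim_block_diag [simp]:
  "dim_row (block_diag A B) = dim_row A + dim_row B"
  "dim_col (block_diag A B) = dim_col A + dim_col B"
  by (simp_all add: block_diag_def)

lemma index_append_cols [simp]:
  assumes "i < dim_row A" "j < dim_col A + dim_col B"
  shows "(A @\<^sub>c B) $$ (i, j) = (if j < dim_col A then A $$ (i, j) else B $$ (i, j - dim_col A))"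
  using assms by (simp add: append_cols_def)

lemma index_append_rows [simp]:
  assumes "i < dim_row A + dim_row B" "j < dim_col A"
  shows "(A @\<^sub>r B) $$ (i, j) = (if i < dim_row A then A $$ (i, j) else B $$ (i - dim_row A, j))"
  using assms by (simp add: append_rows_def)

lemma vec_add_split: "vec (m + k) f = vec m f @\<^sub>v vec k (shift m f)"
  by (rule eq_vecI) (auto simp: shift_def)

text \<open>The lower blocks in \<open>append_cols\<close> have no rows, so the four-block product
  formula contributes only an empty second part.\<close>

lemma append_cols_mult_vec:
  assumes "A \<in> carrier_mat m k" "B \<in> carrier_mat m l" "u \<in> carrier_vec k" "v \<in> carrier_vec l"
  shows "(A @\<^sub>c B) *\<^sub>v (u @\<^sub>v v) = A *\<^sub>v u + B *\<^sub>v v"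
proof -
  have "(A @\<^sub>c B) *\<^sub>v (u @\<^sub>v v) =
      (A *\<^sub>v u + B *\<^sub>v v) @\<^sub>v (0\<^sub>m 0 k *\<^sub>v u + 0\<^sub>m 0 l *\<^sub>v v)"
    unfolding append_cols_def using assms
    by (subst four_block_mat_mult_vec[of _ m k _ l _ 0]) auto
  also have "\<dots> = A *\<^sub>v u + B *\<^sub>v v"
    using assms by (intro eq_vecI) auto
  finally show ?thesis .
qed

lemma dim_mat_apply [simp]: "dim_vec (mat_apply A f) = dim_row A"
  by (simp add: mat_apply_def)

lemma mat_apply_cong: "(\<And>i. i < dim_col A \<Longrightarrow> f i = g i) \<Longrightarrow> mat_apply A f = mat_apply A g"
  unfolding mat_apply_def by (rule arg_cong[where f = "\<lambda>v. A *\<^sub>v v"]) (auto intro: eq_vecI)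

lemma mat_apply_zero [simp]: "mat_apply (0\<^sub>m m k) f = 0\<^sub>v m"
  by (rule eq_vecI) (auto simp: mat_apply_def scalar_prod_def)

lemma mat_apply_mult:
  "dim_row A = dim_col R \<Longrightarrow> mat_apply (R * A) f = R *\<^sub>v mat_apply A f"
  unfolding mat_apply_def
  by (simp add: assoc_mult_mat_vec[of R "dim_row R" "dim_col R" A "dim_col A"])

lemma mat_apply_uminus [simp]: "mat_apply (- A) f = - mat_apply A f"
  by (simp add: mat_apply_def)

lemma mat_apply_append_cols [simp]:
  assumes "dim_row B = dim_row A"
  shows "mat_apply (A @\<^sub>c B) f = mat_apply A f + mat_apply B (shift (dim_col A) f)"
  using assms unfolding mat_apply_def
  by (simp add: vec_add_split append_cols_mult_vec[of A "dim_row A" "dim_col A" B "dim_col B"])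

lemma mat_apply_append_rows [simp]:
  assumes "dim_col B = dim_col A"
  shows "mat_apply (A @\<^sub>r B) f = mat_apply A f @\<^sub>v mat_apply B f"
  using assms unfolding mat_apply_def
  by (simp add: mat_mult_append[of A "dim_row A" "dim_col A" B "dim_row B"])

lemma mat_apply_block_diag [simp]:
  "mat_apply (block_diag A B) f = mat_apply A f @\<^sub>v mat_apply B (shift (dim_col A) f)"
proof -
  let ?u = "vec (dim_col A) f" and ?v = "vec (dim_col B) (shift (dim_col A) f)"
  have "mat_apply (block_diag A B) f =
      (A *\<^sub>v ?u + 0\<^sub>m (dim_row A) (dim_col B) *\<^sub>v ?v) @\<^sub>v (0\<^sub>m (dim_row B) (dim_col A) *\<^sub>v ?u + B *\<^sub>v ?v)"
    unfolding mat_apply_def dim_block_diag vec_add_split unfolding block_diag_def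
    by (subst four_block_mat_mult_vec[of _ "dim_row A" "dim_col A" _ "dim_col B" _ "dim_row B"])
      auto
  also have "\<dots> = mat_apply A f @\<^sub>v mat_apply B (shift (dim_col A) f)"
    by (intro eq_vecI) (auto simp: mat_apply_def scalar_prod_def)
  finally show ?thesis .
qed

lemma add_append_vec [simp]:
  assumes "dim_vec u = dim_vec u'" "dim_vec v = dim_vec v'"
  shows "(u @\<^sub>v v) + (u' @\<^sub>v v') = (u + u') @\<^sub>v (v + v')"
  by (rule append_vec_add[of _ "dim_vec u" _ _ "dim_vec v"]) (use assms in auto)

subsection \<open>Factors of hybrid zonotopes\<close>

definition hz_point :: "hz \<Rightarrow> (nat \<Rightarrow> real) \<Rightarrow> (nat \<Rightarrow> real) \<Rightarrow> real vec" where
  "hz_point Z c b = mat_apply (Gc Z) c + mat_apply (Gb Z) b + ctr Z"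

definition hz_feasible :: "hz \<Rightarrow> (nat \<Rightarrow> real) \<Rightarrow> (nat \<Rightarrow> real) \<Rightarrow> bool" where
  "hz_feasible Z c b \<longleftrightarrow>
     (\<forall>i < dim_col (Gc Z). \<bar>c i\<bar> \<le> 1) \<and> (\<forall>i < dim_col (Gb Z). b i \<in> {-1, 1}) \<and>
     mat_apply (Ac Z) c + mat_apply (Ab Z) b = bvec Z"

lemma hz_carrier_iff:
  "Z \<in> hz_carrier n \<longleftrightarrow>
     dim_row (Gc Z) = n \<and> dim_row (Gb Z) = n \<and> dim_vec (ctr Z) = n \<and>
     dim_col (Ac Z) = dim_col (Gc Z) \<and> dim_col (Ab Z) = dim_col (Gb Z) \<and>
     dim_row (Ab Z) = dim_row (Ac Z) \<and> dim_vec (bvec Z) = dim_row (Ac Z)"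
  by (auto simp: hz_carrier_def)

lemma dim_hz_point: "Z \<in> hz_carrier n \<Longrightarrow> dim_vec (hz_point Z c b) = n"
  by (simp add: hz_carrier_iff hz_point_def)

text \<open>The bridge between factor vectors and factor sequences. Membership in the carrier makes
  the generator matrix and the constraint matrix of each kind read initial segments of equal
  length.\<close>

lemma hz_set_eq:
  assumes "Z \<in> hz_carrier n"
  shows "hz_set Z = {hz_point Z c b | c b. hz_feasible Z c b}"
proof (intro equalityI subsetI)
  fix z assume "z \<in> hz_set Z"
  then obtain \<xi>c \<xi>b where z: "z = Gc Z *\<^sub>v \<xi>c + Gb Z *\<^sub>v \<xi>b + ctr Z"
    and c: "\<xi>c \<in> carrier_vec (dim_col (Gc Z))" "\<forall>i < dim_col (Gc Z). \<bar>\<xi>c $ i\<bar> \<le> 1"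
    and b: "\<xi>b \<in> carrier_vec (dim_col (Gb Z))" "\<forall>i < dim_col (Gb Z). \<xi>b $ i \<in> {-1, 1}"
    and e: "Ac Z *\<^sub>v \<xi>c + Ab Z *\<^sub>v \<xi>b = bvec Z"
    unfolding hz_set_def by blast
  \<comment> \<open>A factor vector becomes a sequence through its own indexing; values beyond its
    dimension are never read.\<close>
  have "vec (dim_col (Gc Z)) (($) \<xi>c) = \<xi>c" "vec (dim_col (Gb Z)) (($) \<xi>b) = \<xi>b"
    using b c by auto
  then have "z = hz_point Z (($) \<xi>c) (($) \<xi>b) \<and> hz_feasible Z (($) \<xi>c) (($) \<xi>b)"
    using assms z c b e by (simp add: hz_point_def hz_feasible_def mat_apply_def hz_carrier_iff)
  then show "z \<in> {hz_point Z c b | c b. hz_feasible Z c b}" by blast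
next
  fix z assume "z \<in> {hz_point Z c b | c b. hz_feasible Z c b}"
  then obtain c b where *: "z = hz_point Z c b" "hz_feasible Z c b" by blast
  show "z \<in> hz_set Z"
    unfolding hz_set_def mem_Collect_eq
    by (rule exI[of _ "vec (dim_col (Gc Z)) c"], rule exI[of _ "vec (dim_col (Gb Z)) b"])
      (use * assms in \<open>simp add: hz_point_def hz_feasible_def mat_apply_def hz_carrier_iff\<close>)
qed

text \<open>Splits the range conditions on the factors of a product or an intersection into those of
  the two operands. Keeping \<open>P\<close> general serves continuous and binary factors
  alike.\<close>

lemma all_less_add_iff: "(\<forall>i < m + k. P (f i)) \<longleftrightarrow> (\<forall>i < m. P (f i)) \<and> (\<forall>i < k. P (shift m f i))"
  for m k :: nat
proof (intro iffI allI impI conjI)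
  fix i assume *: "(\<forall>i < m. P (f i)) \<and> (\<forall>i < k. P (shift m f i))" "i < m + k"
  show "P (f i)"
  proof (cases "i < m")
    case False
    then have "f i = shift m f (i - m)" "i - m < k"
      using *(2) by (auto simp: shift_def)
    with *(1) show ?thesis by simp
  qed (use * in simp)
qed (auto simp: shift_def)

section \<open>Affine images\<close>

lemma hz_affine_carrier:
  assumes "Z \<in> hz_carrier n" "R \<in> carrier_mat m n" "v \<in> carrier_vec m"
  shows "hz_affine R Z v \<in> hz_carrier m"
  using assms by (auto simp: hz_carrier_iff hz_affine_def)

lemma hz_feasible_affine [simp]:
  "hz_feasible (hz_affine R Z v) c b \<longleftrightarrow> hz_feasible Z c b"
  by (simp add: hz_feasible_def hz_affine_def)

lemma hz_point_affine:
  assumes "Z \<in> hz_carrier n" "R \<in> carrier_mat m n" "v \<in> carrier_vec m"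
  shows "hz_point (hz_affine R Z v) c b = R *\<^sub>v hz_point Z c b + v"
proof -
  note Z = assms(1)[unfolded hz_carrier_iff]
  have "R *\<^sub>v hz_point Z c b =
      R *\<^sub>v mat_apply (Gc Z) c + R *\<^sub>v mat_apply (Gb Z) b + R *\<^sub>v ctr Z"
    unfolding hz_point_def using Z assms(2)
    by (simp add: mult_add_distrib_mat_vec[of R m n])
  then show ?thesis
    unfolding hz_point_def hz_affine_def using Z assms(2,3)
    by (auto simp: mat_apply_mult intro!: eq_vecI)
qed

lemma hz_set_affine:
  assumes "Z \<in> hz_carrier n" "R \<in> carrier_mat m n" "v \<in> carrier_vec m"
  shows "hz_set (hz_affine R Z v) = (\<lambda>z. R *\<^sub>v z + v) ` hz_set Z"
  unfolding hz_set_eq[OF hz_affine_carrier[OF assms]] hz_set_eq[OF assms(1)]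
  using hz_point_affine[OF assms] by auto

lemma hz_set_linear:
  assumes "Z \<in> hz_carrier n" "R \<in> carrier_mat m n"
  shows "hz_set (hz_linear R Z) = (\<lambda>z. R *\<^sub>v z) ` hz_set Z"
  using assms by (simp add: hz_set_affine[OF assms])

section \<open>Cartesian products\<close>

lemma hz_prod_carrier:
  assumes "Z \<in> hz_carrier n" "Y \<in> hz_carrier m"
  shows "hz_prod Z Y \<in> hz_carrier (n + m)"
  using assms by (auto simp: hz_carrier_iff hz_prod_def)

lemma hz_point_prod:
  assumes "Z \<in> hz_carrier n" "Y \<in> hz_carrier m"
  shows "hz_point (hz_prod Z Y) c b =
    hz_point Z c b @\<^sub>v hz_point Y (shift (dim_col (Gc Z)) c) (shift (dim_col (Gb Z)) b)"
  using assms by (simp add: hz_point_def hz_prod_def hz_carrier_iff)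

lemma append_vec_assoc: "(u @\<^sub>v v) @\<^sub>v w = u @\<^sub>v v @\<^sub>v w"
  by (rule eq_vecI) auto

lemma append_vec_eq_iff:
  "dim_vec u = dim_vec u' \<Longrightarrow> u @\<^sub>v v = u' @\<^sub>v v' \<longleftrightarrow> u = u' \<and> v = v'"
  by (rule append_vec_eq[of _ "dim_vec u"]) auto

lemma hz_feasible_prod:
  assumes "Z \<in> hz_carrier n" "Y \<in> hz_carrier m"
  shows "hz_feasible (hz_prod Z Y) c b \<longleftrightarrow>
    hz_feasible Z c b \<and> hz_feasible Y (shift (dim_col (Gc Z)) c) (shift (dim_col (Gb Z)) b)"
  using assms
  \<comment> \<open>The second instance of \<open>P\<close> is membership in \<open>{-1, 1}\<close>
    as the simplifier writes it.\<close>
  by (auto simp: hz_feasible_def hz_prod_def hz_carrier_iff append_vec_eq_iff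
      all_less_add_iff[where P = "\<lambda>x. \<bar>x\<bar> \<le> 1"] all_less_add_iff[where P = "\<lambda>x. x = -1 \<or> x = 1"])

lemma hz_feasible_cong:
  assumes "Z \<in> hz_carrier n"
    and "\<And>i. i < dim_col (Gc Z) \<Longrightarrow> c i = c' i" "\<And>i. i < dim_col (Gb Z) \<Longrightarrow> b i = b' i"
  shows "hz_feasible Z c b \<longleftrightarrow> hz_feasible Z c' b'"
  using assms mat_apply_cong[of "Ac Z" c c'] mat_apply_cong[of "Ab Z" b b']
  by (simp add: hz_feasible_def hz_carrier_iff)

lemma hz_point_cong:
  assumes "\<And>i. i < dim_col (Gc Z) \<Longrightarrow> c i = c' i" "\<And>i. i < dim_col (Gb Z) \<Longrightarrow> b i = b' i"
  shows "hz_point Z c b = hz_point Z c' b'"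
  using assms mat_apply_cong[of "Gc Z" c c'] mat_apply_cong[of "Gb Z" b b']
  by (simp add: hz_point_def)

lemma hz_point_glue [simp]:
  "hz_point Z (glue (dim_col (Gc Z)) c c') (glue (dim_col (Gb Z)) b b') = hz_point Z c b"
  by (rule hz_point_cong) auto

lemma hz_feasible_glue [simp]:
  assumes "Z \<in> hz_carrier n"
  shows "hz_feasible Z (glue (dim_col (Gc Z)) c c') (glue (dim_col (Gb Z)) b b') \<longleftrightarrow> hz_feasible Z c b"
  by (rule hz_feasible_cong[OF assms]) auto

text \<open>The operands share no factors: a pair for the product splits by \<open>shift\<close>,
  and any two pairs combine by \<open>glue\<close>.\<close>

lemma hz_set_prod:
  assumes "Z \<in> hz_carrier n" "Y \<in> hz_carrier m"
  shows "hz_set (hz_prod Z Y) = {z @\<^sub>v y | z y. z \<in> hz_set Z \<and> y \<in> hz_set Y}"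
proof (intro equalityI subsetI)
  fix x assume "x \<in> hz_set (hz_prod Z Y)"
  then show "x \<in> {z @\<^sub>v y | z y. z \<in> hz_set Z \<and> y \<in> hz_set Y}"
    unfolding hz_set_eq[OF hz_prod_carrier[OF assms]] hz_set_eq[OF assms(1)] hz_set_eq[OF assms(2)]
    by (auto simp: hz_point_prod[OF assms] hz_feasible_prod[OF assms])
next
  fix x assume "x \<in> {z @\<^sub>v y | z y. z \<in> hz_set Z \<and> y \<in> hz_set Y}"
  then obtain c b c' b' where *: "hz_feasible Z c b" "hz_feasible Y c' b'"
      "x = hz_point Z c b @\<^sub>v hz_point Y c' b'"
    unfolding hz_set_eq[OF assms(1)] hz_set_eq[OF assms(2)] by auto
  show "x \<in> hz_set (hz_prod Z Y)"
    unfolding hz_set_eq[OF hz_prod_carrier[OF assms]] mem_Collect_eq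
    by (rule exI[of _ "glue (dim_col (Gc Z)) c c'"], rule exI[of _ "glue (dim_col (Gb Z)) b b'"],
        simp add: * hz_point_prod[OF assms] hz_feasible_prod[OF assms] hz_feasible_glue[OF assms(1)])
qed

section \<open>Generalized intersections\<close>

lemma hz_inter_carrier:
  assumes "Z \<in> hz_carrier n" "Y \<in> hz_carrier m" "R \<in> carrier_mat m n"
  shows "hz_inter R Z Y \<in> hz_carrier n"
  using assms by (auto simp: hz_carrier_iff hz_inter_def)

lemma hz_point_inter:
  assumes "Z \<in> hz_carrier n"
  shows "hz_point (hz_inter R Z Y) c b =
    hz_point Z (shift (dim_col (Gc Y)) c) (shift (dim_col (Gb Y)) b)"
  using assms by (auto simp: hz_point_def hz_inter_def hz_carrier_iff intro!: eq_vecI)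

text \<open>The first two block rows are the constraints of the operands. The third one couples
  them: it is the equation between the image of the point of \<open>Z\<close> and the point of
  \<open>Y\<close>, with the centers moved to the right-hand side.\<close>

lemma hz_feasible_inter:
  assumes "Z \<in> hz_carrier n" "Y \<in> hz_carrier m" "R \<in> carrier_mat m n"
  defines "c' \<equiv> shift (dim_col (Gc Y))" and "b' \<equiv> shift (dim_col (Gb Y))"
  shows "hz_feasible (hz_inter R Z Y) c b \<longleftrightarrow>
    hz_feasible Y c b \<and> hz_feasible Z (c' c) (b' b) \<and>
    R *\<^sub>v hz_point Z (c' c) (b' b) = hz_point Y c b"
proof -
  let ?c = "c' c" and ?b = "b' b"
  let ?p = "mat_apply (Gc Y) c" and ?q = "mat_apply (Gb Y) b"
    and ?r = "R *\<^sub>v mat_apply (Gc Z) ?c" and ?s = "R *\<^sub>v mat_apply (Gb Z) ?b"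
  note dims = assms(1,2)[unfolded hz_carrier_iff] assms(3)[unfolded carrier_mat_iff]
  have R: "R *\<^sub>v hz_point Z ?c ?b = ?r + ?s + R *\<^sub>v ctr Z"
    unfolding hz_point_def using dims
    by (simp add: mult_add_distrib_mat_vec[of R m n])
  have link: "(- ?p + ?r) + (- ?q + ?s) = ctr Y - R *\<^sub>v ctr Z \<longleftrightarrow>
      R *\<^sub>v hz_point Z ?c ?b = hz_point Y c b"
    unfolding R using dims by (auto simp: hz_point_def vec_eq_iff algebra_simps)
  have "mat_apply (Ac (hz_inter R Z Y)) c + mat_apply (Ab (hz_inter R Z Y)) b =
      (mat_apply (Ac Y) c + mat_apply (Ab Y) b) @\<^sub>v (mat_apply (Ac Z) ?c + mat_apply (Ab Z) ?b) @\<^sub>v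
      ((- ?p + ?r) + (- ?q + ?s))"
    using dims by (simp add: hz_inter_def c'_def b'_def mat_apply_mult append_vec_assoc)
  then have "mat_apply (Ac (hz_inter R Z Y)) c + mat_apply (Ab (hz_inter R Z Y)) b =
      bvec (hz_inter R Z Y) \<longleftrightarrow>
      mat_apply (Ac Y) c + mat_apply (Ab Y) b = bvec Y \<and>
      mat_apply (Ac Z) ?c + mat_apply (Ab Z) ?b = bvec Z \<and>
      R *\<^sub>v hz_point Z ?c ?b = hz_point Y c b"
    unfolding link[symmetric] using dims by (simp add: hz_inter_def append_vec_eq_iff)
  then show ?thesis
    unfolding hz_feasible_def
    by (auto simp: hz_inter_def c'_def b'_def
      all_less_add_iff[where P = "\<lambda>x. \<bar>x\<bar> \<le> 1"] all_less_add_iff[where P = "\<lambda>x. x = -1 \<or> x = 1"])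
qed

lemma hz_set_inter:
  assumes "Z \<in> hz_carrier n" "Y \<in> hz_carrier m" "R \<in> carrier_mat m n"
  shows "hz_set (hz_inter R Z Y) = {z \<in> hz_set Z. R *\<^sub>v z \<in> hz_set Y}"
proof (intro equalityI subsetI)
  fix z assume "z \<in> hz_set (hz_inter R Z Y)"
  then show "z \<in> {z \<in> hz_set Z. R *\<^sub>v z \<in> hz_set Y}"
    unfolding hz_set_eq[OF hz_inter_carrier[OF assms]] hz_set_eq[OF assms(1)] hz_set_eq[OF assms(2)]
    by (auto simp: hz_point_inter[OF assms(1)] hz_feasible_inter[OF assms])
next
  fix z assume "z \<in> {z \<in> hz_set Z. R *\<^sub>v z \<in> hz_set Y}"
  then obtain c b c' b' where *: "hz_feasible Z c b" "z = hz_point Z c b"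
      "hz_feasible Y c' b'" "R *\<^sub>v z = hz_point Y c' b'"
    unfolding hz_set_eq[OF assms(1)] hz_set_eq[OF assms(2)] by auto
  show "z \<in> hz_set (hz_inter R Z Y)"
    unfolding hz_set_eq[OF hz_inter_carrier[OF assms]] mem_Collect_eq
    \<comment> \<open>The factors of \<open>Y\<close> come first, as its generators do in
      \<open>hz_inter\<close>.\<close>
    by (rule exI[of _ "glue (dim_col (Gc Y)) c' c"], rule exI[of _ "glue (dim_col (Gb Y)) b' b"],
        simp add: *(1,3) *(4)[unfolded *(2)] *(2) hz_point_inter[OF assms(1)] hz_feasible_inter[OF assms]
          hz_feasible_glue[OF assms(2)])
qed

lemma index_block_diag [simp]:
  assumes "i < dim_row A + dim_row B" "j < dim_col A + dim_col B"
  shows "block_diag A B $$ (i, j) =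
    (if i < dim_row A then if j < dim_col A then A $$ (i, j) else 0
     else if j < dim_col A then 0 else B $$ (i - dim_row A, j - dim_col A))"
  using assms by (simp add: block_diag_def)

subsection \<open>Lifting of factors\<close>

text \<open>The first three conditions say entrywise what \<^const>\<open>hz_extends\<close> says by block matrices.
  The last two say that the factors feasible for \<open>Z\<close> are exactly the restrictions of those
  feasible for \<open>Y\<close>.\<close>

definition hz_lifts :: "hz \<Rightarrow> hz \<Rightarrow> bool" where
  "hz_lifts Z Y \<longleftrightarrow>
     dim_col (Gc Z) \<le> dim_col (Gc Y) \<and> dim_col (Gb Z) \<le> dim_col (Gb Y) \<and>
     dim_row (Ac Z) \<le> dim_row (Ac Y) \<and>
     (\<forall>i < dim_row (Ac Z).
        (\<forall>j < dim_col (Gc Y). Ac Y $$ (i, j) = (if j < dim_col (Gc Z) then Ac Z $$ (i, j) else 0)) \<and>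
        (\<forall>j < dim_col (Gb Y). Ab Y $$ (i, j) = (if j < dim_col (Gb Z) then Ab Z $$ (i, j) else 0)) \<and>
        bvec Y $ i = bvec Z $ i) \<and>
     (\<forall>c b. hz_feasible Y c b \<longrightarrow> hz_feasible Z c b) \<and>
     (\<forall>c b. hz_feasible Z c b \<longrightarrow> (\<exists>c' b'. hz_feasible Y c' b' \<and>
        (\<forall>i < dim_col (Gc Z). c' i = c i) \<and> (\<forall>i < dim_col (Gb Z). b' i = b i)))"

lemma hz_lifts_refl: "Z \<in> hz_carrier n \<Longrightarrow> hz_lifts Z Z"
  unfolding hz_lifts_def by auto

text \<open>The entrywise form lets zero padding compose without block algebra. Factors are extended
  twice, and the second extension agrees with the original ones because the numbers of generators
  only grow.\<close>

lemma hz_lifts_trans: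
  assumes "hz_lifts Z Y" "hz_lifts Y W"
  shows "hz_lifts Z W"
proof -
  have lift: "\<exists>c' b'. hz_feasible W c' b' \<and>
      (\<forall>i < dim_col (Gc Z). c' i = c i) \<and> (\<forall>i < dim_col (Gb Z). b' i = b i)"
    if "hz_feasible Z c b" for c b
  proof -
    obtain c' b' where 1: "hz_feasible Y c' b'" "\<forall>i < dim_col (Gc Z). c' i = c i"
        "\<forall>i < dim_col (Gb Z). b' i = b i"
      using assms(1) \<open>hz_feasible Z c b\<close> unfolding hz_lifts_def by blast
    obtain c'' b'' where 2: "hz_feasible W c'' b''" "\<forall>i < dim_col (Gc Y). c'' i = c' i"
        "\<forall>i < dim_col (Gb Y). b'' i = b' i"
      using assms(2) 1(1) unfolding hz_lifts_def by blast
    have "dim_col (Gc Z) \<le> dim_col (Gc Y)" "dim_col (Gb Z) \<le> dim_col (Gb Y)"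
      using assms(1) by (simp_all add: hz_lifts_def)
    with 1 2 show ?thesis
      by (intro exI[of _ c''] exI[of _ b'']) auto
  qed
  show ?thesis
    unfolding hz_lifts_def
  proof (intro conjI allI impI)
    fix c b assume "hz_feasible W c b"
    then show "hz_feasible Z c b" using assms unfolding hz_lifts_def by blast
  next
    fix c b assume "hz_feasible Z c b"
    then show "\<exists>c' b'. hz_feasible W c' b' \<and>
      (\<forall>i < dim_col (Gc Z). c' i = c i) \<and> (\<forall>i < dim_col (Gb Z). b' i = b i)" by (rule lift)
  qed (use assms in \<open>auto simp: hz_lifts_def\<close>)
qed

text \<open>Discharges the side condition of \<open>hz_cprod\<close>. The witnesses are the surplus
  columns of \<open>Y\<close> and the rows of \<open>Y\<close> below those inherited from
  \<open>Z\<close>.\<close>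

lemma hz_lifts_extends:
  assumes Z: "Z \<in> hz_carrier n" and Y: "Y \<in> hz_carrier m" and "hz_lifts Z Y"
  shows "hz_extends Z Y"
proof -
  note d = Z[unfolded hz_carrier_iff] Y[unfolded hz_carrier_iff] assms(3)[unfolded hz_lifts_def]
  let ?r = "dim_row (Ac Z)"
  let ?low = "\<lambda>A. mat (dim_row A - ?r) (dim_col A) (\<lambda>(i, j). A $$ (i + ?r, j))"
  have "Ac Y = (Ac Z @\<^sub>c 0\<^sub>m ?r (dim_col (Gc Y) - dim_col (Gc Z))) @\<^sub>r ?low (Ac Y)"
    by (rule eq_matI) (use d in auto)
  moreover have "Ab Y = (Ab Z @\<^sub>c 0\<^sub>m (dim_row (Ab Z)) (dim_col (Gb Y) - dim_col (Gb Z))) @\<^sub>r ?low (Ab Y)"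
    by (rule eq_matI) (use d in auto)
  moreover have "bvec Y = bvec Z @\<^sub>v vec (dim_row (Ac Y) - ?r) (\<lambda>i. bvec Y $ (i + ?r))"
    by (rule eq_vecI) (use d in auto)
  ultimately show ?thesis unfolding hz_extends_def by blast
qed

text \<open>Under a lift the constrained product is the defined branch, and one pair of factors
  evaluates in both operands at once. It keeps the constraints and the numbers of generators of
  \<open>Y\<close>, so lifting cannot distinguish it from \<open>Y\<close>.\<close>

lemma
  assumes Z: "Z \<in> hz_carrier n" and Y: "Y \<in> hz_carrier m" and L: "hz_lifts Z Y"
  shows hz_cprod_carrier: "hz_cprod Z Y \<in> hz_carrier (n + m)"
    and hz_point_cprod: "hz_point (hz_cprod Z Y) c b = hz_point Z c b @\<^sub>v hz_point Y c b"
    and hz_feasible_cprod: "hz_feasible (hz_cprod Z Y) c b \<longleftrightarrow> hz_feasible Y c b"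
    and hz_lifts_cprod_iff: "hz_lifts (hz_cprod Z Y) W \<longleftrightarrow> hz_lifts Y W"
    and hz_lifts_cprod_right: "hz_lifts W (hz_cprod Z Y) \<longleftrightarrow> hz_lifts W Y"
proof -
  note d = Z[unfolded hz_carrier_iff] Y[unfolded hz_carrier_iff] L[unfolded hz_lifts_def]
  note P = hz_cprod_def[of Z Y] if_P[OF hz_lifts_extends[OF Z Y L]]
  show "hz_cprod Z Y \<in> hz_carrier (n + m)"
    unfolding P using d by (simp add: hz_carrier_iff)
  show "hz_point (hz_cprod Z Y) c b = hz_point Z c b @\<^sub>v hz_point Y c b"
    unfolding P hz_point_def using d by simp
  show *: "hz_feasible (hz_cprod Z Y) c b \<longleftrightarrow> hz_feasible Y c b" for c b
    unfolding P hz_feasible_def using d by simp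
  show "hz_lifts (hz_cprod Z Y) W \<longleftrightarrow> hz_lifts Y W"
    unfolding hz_lifts_def * unfolding P using d by simp
  show "hz_lifts W (hz_cprod Z Y) \<longleftrightarrow> hz_lifts W Y"
    unfolding hz_lifts_def * unfolding P using d by simp
qed

lemma hz_lifts_affine_iff [simp]: "hz_lifts (hz_affine R Z v) W \<longleftrightarrow> hz_lifts Z W"
  unfolding hz_lifts_def hz_feasible_affine by (simp add: hz_affine_def)

lemma hz_lifts_affine_right [simp]: "hz_lifts W (hz_affine R Z v) \<longleftrightarrow> hz_lifts W Z"
  unfolding hz_lifts_def hz_feasible_affine by (simp add: hz_affine_def)

section \<open>The ReLU graph over a box\<close>

lemma hz_unit_carrier: "hz_unit \<in> hz_carrier 0"
  by (simp add: hz_carrier_iff hz_unit_def)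

lemma hz_set_unit: "hz_set hz_unit = {0\<^sub>v 0}"
  unfolding hz_set_eq[OF hz_unit_carrier]
  by (auto simp: hz_point_def hz_feasible_def hz_unit_def)

text \<open>Induction along the coordinates, each factor of the product adding one pair of input and
  output in front. A list with arbitrary bound functions replaces the index range, which would not
  be preserved in the step.\<close>

lemma relu_graph_product:
  assumes G: "relu_graph_hz G" and "\<And>i. i \<in> set xs \<Longrightarrow> lo i \<le> hi i"
  defines "Q \<equiv> foldr hz_prod (map (\<lambda>i. G (lo i) (hi i)) xs) hz_unit"
  shows "Q \<in> hz_carrier (2 * length xs) \<and>
    hz_set Q = {v \<in> carrier_vec (2 * length xs). \<forall>k < length xs.
      lo (xs ! k) \<le> v $ (2 * k) \<and> v $ (2 * k) \<le> hi (xs ! k) \<and>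
      v $ Suc (2 * k) = max (v $ (2 * k)) 0}"
  using assms(2) unfolding Q_def
proof (induction xs)
  case Nil
  show ?case by (auto simp: hz_unit_carrier hz_set_unit intro!: eq_vecI)
next
  case (Cons x xs)
  let ?P = "foldr hz_prod (map (\<lambda>i. G (lo i) (hi i)) xs) hz_unit" and ?H = "G (lo x) (hi x)"
  let ?ok = "\<lambda>xs v. \<forall>k < length xs.
      lo (xs ! k) \<le> v $ (2 * k) \<and> v $ (2 * k) \<le> hi (xs ! k) \<and> v $ Suc (2 * k) = max (v $ (2 * k)) 0"
  have P: "?P \<in> hz_carrier (2 * length xs)"
    "hz_set ?P = {v \<in> carrier_vec (2 * length xs). ?ok xs v}"
    using Cons by auto
  have H: "?H \<in> hz_carrier 2"
    "hz_set ?H = {vec_of_list [s, max s 0] | s. lo x \<le> s \<and> s \<le> hi x}"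
    using G Cons.prems[of x] by (auto simp: relu_graph_hz_def)
  have "hz_set (hz_prod ?H ?P) = {v \<in> carrier_vec (2 * length (x # xs)). ?ok (x # xs) v}"
    unfolding hz_set_prod[OF H(1) P(1)]
  proof (intro equalityI subsetI)
    fix v assume "v \<in> {z @\<^sub>v y | z y. z \<in> hz_set ?H \<and> y \<in> hz_set ?P}"
    then obtain s y where v: "v = vec_of_list [s, max s 0] @\<^sub>v y" "lo x \<le> s" "s \<le> hi x"
        "dim_vec y = 2 * length xs" "?ok xs y"
      unfolding H(2) P(2) by auto
    have "?ok (x # xs) v"
    proof (intro allI impI)
      fix k assume k: "k < length (x # xs)"
      show "lo ((x # xs) ! k) \<le> v $ (2 * k) \<and> v $ (2 * k) \<le> hi ((x # xs) ! k) \<and>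
        v $ Suc (2 * k) = max (v $ (2 * k)) 0"
        using v k by (cases k) auto
    qed
    with v show "v \<in> {v \<in> carrier_vec (2 * length (x # xs)). ?ok (x # xs) v}" by simp
  next
    fix v assume "v \<in> {v \<in> carrier_vec (2 * length (x # xs)). ?ok (x # xs) v}"
    then have d: "dim_vec v = 2 + 2 * length xs" and ok: "?ok (x # xs) v" by auto
    let ?y = "vec (2 * length xs) (\<lambda>i. v $ (i + 2))"
    have "v = vec_of_list [v $ 0, max (v $ 0) 0] @\<^sub>v ?y"
    proof (rule eq_vecI)
      fix i assume "i < dim_vec (vec_of_list [v $ 0, max (v $ 0) 0] @\<^sub>v ?y)"
      then show "v $ i = (vec_of_list [v $ 0, max (v $ 0) 0] @\<^sub>v ?y) $ i"
        \<comment> \<open>Entries 0 and 1 belong to the first graph, the later ones to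
          \<open>?y\<close>.\<close>
        using ok[rule_format, of 0] by (cases i; cases "i - 1") auto
    qed (simp add: d)
    moreover have "?ok xs ?y"
      using ok[rule_format, of "Suc _"] by simp
    ultimately show "v \<in> {z @\<^sub>v y | z y. z \<in> hz_set ?H \<and> y \<in> hz_set ?P}"
      unfolding H(2) P(2) mem_Collect_eq using ok[rule_format, of 0]
      by (intro exI[of _ "vec_of_list [v $ 0, max (v $ 0) 0]"] exI[of _ ?y] conjI exI[of _ "v $ 0"]) auto
  qed
  moreover have "hz_prod ?H ?P \<in> hz_carrier (2 * length (x # xs))"
    using hz_prod_carrier[OF H(1) P(1)] by simp
  ultimately show ?case by simp
qed

subsection \<open>The ReLU step\<close>

lemma dim_blocks [simp]:
  "dim_row (first_block m) = m" "dim_col (first_block m) = 2 * m"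
  "dim_row (second_block m) = m" "dim_col (second_block m) = 2 * m"
  by (auto simp: first_block_def second_block_def)

lemma first_block_append:
  "dim_vec u = m \<Longrightarrow> dim_vec v = m \<Longrightarrow> first_block m *\<^sub>v (u @\<^sub>v v) = u"
  unfolding first_block_def
  \<comment> \<open>Only scalar products with rows of the zero block are unfolded.\<close>
  by (subst append_cols_mult_vec[of _ m m _ m]) (auto intro!: eq_vecI simp: scalar_prod_def[of "row (0\<^sub>m _ _) _"])

lemma second_block_append:
  "dim_vec u = m \<Longrightarrow> dim_vec v = m \<Longrightarrow> second_block m *\<^sub>v (u @\<^sub>v v) = v"
  unfolding second_block_def
  by (subst append_cols_mult_vec[of _ m m _ m]) (auto intro!: eq_vecI simp: scalar_prod_def[of "row (0\<^sub>m _ _) _"])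

lemma io_perm_mult:
  assumes "dim_vec v = 2 * m"
  shows "io_perm m *\<^sub>v v = vec m (\<lambda>i. v $ (2 * i)) @\<^sub>v vec m (\<lambda>i. v $ Suc (2 * i))"
proof (rule eq_vecI)
  fix i assume "i < dim_vec (vec m (\<lambda>i. v $ (2 * i)) @\<^sub>v vec m (\<lambda>i. v $ Suc (2 * i)))"
  then have i: "i < 2 * m" by simp
  \<comment> \<open>The interleaved position from which coordinate \<open>i\<close> is
    copied.\<close>
  let ?k = "if i < m then 2 * i else 2 * (i - m) + 1"
  have k: "?k < 2 * m" using i by auto
  have "row (io_perm m) i = unit_vec (2 * m) ?k"
    using i by (intro eq_vecI) (auto simp: io_perm_def unit_vec_def)
  then have "(io_perm m *\<^sub>v v) $ i = v $ ?k"
    using i k assms by (simp add: io_perm_def del: One_nat_def)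
  then show "(io_perm m *\<^sub>v v) $ i = (vec m (\<lambda>i. v $ (2 * i)) @\<^sub>v vec m (\<lambda>i. v $ Suc (2 * i))) $ i"
    using i by auto
qed (simp add: io_perm_def)

text \<open>The ordering of the bounds makes every coordinate graph available; the permutation then
  sorts the interleaved pairs into an input half and an output half.\<close>

lemma
  fixes m :: nat
  assumes G: "relu_graph_hz G" and I: "box_enclosure m A I"
  defines "P \<equiv> hz_linear (io_perm m) (relu_graph_box G I)"
  shows relu_box_carrier: "P \<in> hz_carrier (2 * m)"
    and hz_set_relu_box: "hz_set P = {s @\<^sub>v relu s | s.
      s \<in> carrier_vec m \<and> (\<forall>i < m. fst I $ i \<le> s $ i \<and> s $ i \<le> snd I $ i)}"
proof -
  let ?Q = "relu_graph_box G I"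
  have dI: "dim_vec (fst I) = m" "dim_vec (snd I) = m" and le: "\<forall>i < m. fst I $ i \<le> snd I $ i"
    using I by (auto simp: box_enclosure_def)
  have Q: "?Q \<in> hz_carrier (2 * m)" "hz_set ?Q = {v \<in> carrier_vec (2 * m). \<forall>k < m.
      fst I $ k \<le> v $ (2 * k) \<and> v $ (2 * k) \<le> snd I $ k \<and> v $ Suc (2 * k) = max (v $ (2 * k)) 0}"
    using relu_graph_product[OF G, of "[0..<m]" "\<lambda>i. fst I $ i" "\<lambda>i. snd I $ i"] le
    by (simp_all add: relu_graph_box_def dI)
  have perm: "io_perm m \<in> carrier_mat (2 * m) (2 * m)" by (simp add: io_perm_def)
  show "P \<in> hz_carrier (2 * m)"
    unfolding P_def by (rule hz_affine_carrier[OF Q(1) perm]) (simp add: io_perm_def)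
  show "hz_set P = {s @\<^sub>v relu s | s.
      s \<in> carrier_vec m \<and> (\<forall>i < m. fst I $ i \<le> s $ i \<and> s $ i \<le> snd I $ i)}" (is "_ = ?S")
    unfolding P_def hz_set_linear[OF Q(1) perm]
  proof (intro equalityI subsetI)
    fix p assume "p \<in> (\<lambda>v. io_perm m *\<^sub>v v) ` hz_set ?Q"
    then obtain v where v: "p = io_perm m *\<^sub>v v" "v \<in> hz_set ?Q" by blast
    let ?s = "vec m (\<lambda>i. v $ (2 * i))"
    have "vec m (\<lambda>i. v $ Suc (2 * i)) = relu ?s"
      using v(2) unfolding Q(2) by (intro eq_vecI) (auto simp: relu_def)
    moreover have "dim_vec v = 2 * m" using v(2) unfolding Q(2) by simp
    ultimately have "p = ?s @\<^sub>v relu ?s" using v(1) io_perm_mult by simp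
    moreover have "\<forall>i < m. fst I $ i \<le> ?s $ i \<and> ?s $ i \<le> snd I $ i"
      using v(2) unfolding Q(2) by simp
    ultimately show "p \<in> ?S"
      unfolding mem_Collect_eq by (intro exI[of _ ?s]) simp
  next
    fix p assume "p \<in> ?S"
    then obtain s where s: "p = s @\<^sub>v relu s" "dim_vec s = m"
        "\<forall>i < m. fst I $ i \<le> s $ i \<and> s $ i \<le> snd I $ i" by auto
    \<comment> \<open>The preimage under the permutation: inputs at even positions, outputs at odd
      ones.\<close>
    let ?v = "vec (2 * m) (\<lambda>i. if even i then s $ (i div 2) else max (s $ (i div 2)) 0)"
    have "?v \<in> hz_set ?Q" unfolding Q(2) using s by simp
    moreover have "p = io_perm m *\<^sub>v ?v"
      unfolding s(1) by (subst io_perm_mult) (use s(2) in \<open>auto simp: relu_def intro!: eq_vecI\<close>)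
    ultimately show "p \<in> (\<lambda>v. io_perm m *\<^sub>v v) ` hz_set ?Q" by blast
  qed
qed

lemma dim_relu [simp]: "dim_vec (relu v) = dim_vec v"
  by (simp add: relu_def)

text \<open>The coupling equation forces the input half of the graph point to be the point of
  \<open>Z\<close>, so the output half is its ReLU. In \<open>relu_hz\<close> the argument is the
  second operand of \<open>hz_inter\<close>; its generators and constraints therefore come first,
  which is the block form required for lifting.\<close>

lemma
  assumes G: "relu_graph_hz G" and I: "box_enclosure m (hz_set Z) I" and Z: "Z \<in> hz_carrier m"
  shows relu_hz_carrier: "relu_hz G I Z \<in> hz_carrier m"
    and relu_hz_point:
      "hz_feasible (relu_hz G I Z) c b \<Longrightarrow> hz_point (relu_hz G I Z) c b = relu (hz_point Z c b)"
    and relu_hz_lifts: "hz_lifts Z (relu_hz G I Z)"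
proof -
  let ?P = "hz_linear (io_perm m) (relu_graph_box G I)"
  let ?J = "hz_inter (first_block m) ?P Z"
  let ?c = "shift (dim_col (Gc Z))" and ?b = "shift (dim_col (Gb Z))"
  note P = relu_box_carrier[OF G I] hz_set_relu_box[OF G I]
  have F: "first_block m \<in> carrier_mat m (2 * m)" and S: "second_block m \<in> carrier_mat m (2 * m)"
    by simp_all
  have J: "?J \<in> hz_carrier (2 * m)" by (rule hz_inter_carrier[OF P(1) Z F])
  have H: "relu_hz G I Z = hz_affine (second_block m) ?J (0\<^sub>v m)"
    using Z by (simp add: relu_hz_def hz_carrier_iff Let_def)
  have feas: "hz_feasible (relu_hz G I Z) c b \<longleftrightarrow>
      hz_feasible Z c b \<and> hz_feasible ?P (?c c) (?b b) \<and>
      first_block m *\<^sub>v hz_point ?P (?c c) (?b b) = hz_point Z c b" for c b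
    unfolding H hz_feasible_affine[of _ ?J] by (rule hz_feasible_inter[OF P(1) Z F])
  show "relu_hz G I Z \<in> hz_carrier m"
    unfolding H by (rule hz_affine_carrier[OF J S]) simp
  show "hz_point (relu_hz G I Z) c b = relu (hz_point Z c b)"
    if *: "hz_feasible (relu_hz G I Z) c b"
  proof -
    have "hz_point ?P (?c c) (?b b) \<in> hz_set ?P"
      using * unfolding feas hz_set_eq[OF P(1)] by blast
    then obtain s where s: "hz_point ?P (?c c) (?b b) = s @\<^sub>v relu s" "dim_vec s = m"
      unfolding P(2) by auto
    have "hz_point (relu_hz G I Z) c b = second_block m *\<^sub>v hz_point ?P (?c c) (?b b) + 0\<^sub>v m"
      unfolding H by (subst hz_point_affine[OF J S]) (simp_all add: hz_point_inter[OF P(1)])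
    also have "\<dots> = relu s"
      unfolding s(1) using s(2) by (simp add: second_block_append)
    also have "s = hz_point Z c b"
      using * s(2) unfolding feas s(1) by (simp add: first_block_append)
    finally show ?thesis .
  qed
  have lift: "\<exists>c' b'. hz_feasible (relu_hz G I Z) c' b' \<and>
      (\<forall>i < dim_col (Gc Z). c' i = c i) \<and> (\<forall>i < dim_col (Gb Z). b' i = b i)"
    if z: "hz_feasible Z c b" for c b
  proof -
    let ?s = "hz_point Z c b"
    have d: "dim_vec ?s = m" by (rule dim_hz_point[OF Z])
    have "?s \<in> hz_set Z" using z unfolding hz_set_eq[OF Z] by blast
    \<comment> \<open>Here soundness of the box enters: the graph contains a point above
      \<open>?s\<close>.\<close>
    then have "?s @\<^sub>v relu ?s \<in> hz_set ?P"
      using I d unfolding P(2) box_enclosure_def by auto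
    then obtain c' b' where p: "hz_feasible ?P c' b'" "hz_point ?P c' b' = ?s @\<^sub>v relu ?s"
      unfolding hz_set_eq[OF P(1)] by auto
    have "hz_feasible (relu_hz G I Z) (glue (dim_col (Gc Z)) c c') (glue (dim_col (Gb Z)) b b')"
      unfolding feas using z p d Z by (simp add: first_block_append)
    moreover have "\<forall>i < dim_col (Gc Z). glue (dim_col (Gc Z)) c c' i = c i"
      "\<forall>i < dim_col (Gb Z). glue (dim_col (Gb Z)) b b' i = b i" by simp_all
    ultimately show ?thesis by blast
  qed
  note dims = Z[unfolded hz_carrier_iff] P(1)[unfolded hz_carrier_iff]
  show "hz_lifts Z (relu_hz G I Z)"
    unfolding hz_lifts_def
  proof (intro conjI allI impI)
    fix c b assume "hz_feasible (relu_hz G I Z) c b"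
    then show "hz_feasible Z c b" by (simp add: feas)
  next
    fix c b assume "hz_feasible Z c b"
    then show "\<exists>c' b'. hz_feasible (relu_hz G I Z) c' b' \<and>
      (\<forall>i < dim_col (Gc Z). c' i = c i) \<and> (\<forall>i < dim_col (Gb Z). b' i = b i)" by (rule lift)
  qed (use dims in \<open>simp_all add: H hz_affine_def[of "second_block m"] hz_inter_def\<close>)
qed

subsection \<open>Trajectories\<close>

text \<open>The induction hypothesis: the set of index \<open>(t, l)\<close> carries, factor by factor, the hidden
  state of the trajectory that starts at the point of \<open>X\<close> with the same factors.\<close>

definition tracks :: "rnn \<Rightarrow> hz \<Rightarrow> nat \<Rightarrow> nat \<Rightarrow> hz \<Rightarrow> bool" where
  "tracks N X t l H \<longleftrightarrow> H \<in> hz_carrier (width N l) \<and> hz_lifts X H \<and>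
     (\<forall>c b. hz_feasible H c b \<longrightarrow> hz_point H c b = rnn_state N (hz_point X c b) t l)"

context
  fixes n :: nat and N :: rnn and X :: hz
    and G :: "real \<Rightarrow> real \<Rightarrow> hz" and B :: "nat \<Rightarrow> nat \<Rightarrow> hz \<Rightarrow> real vec \<times> real vec"
  assumes N: "rnn_wf n N" and X: "X \<in> hz_carrier n"
    and G: "relu_graph_hz G" and B: "sound_boxes B"
begin

private abbreviation "H \<equiv> layer_hz G B N X"

text \<open>The common induction step for all three kinds of ReLU step. The indices \<open>i\<close>
  and \<open>j\<close> are free because soundness of \<open>B\<close> is uniform in them.\<close>

lemma tracks_relu:
  assumes Z: "Z \<in> hz_carrier (width N l)" and XZ: "hz_lifts X Z"
    and pt: "\<And>c b. hz_feasible Z c b \<Longrightarrow> relu (hz_point Z c b) = rnn_state N (hz_point X c b) t l"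
  shows "tracks N X t l (relu_hz G (B i j Z) Z)" "hz_lifts Z (relu_hz G (B i j Z) Z)"
proof -
  have I: "box_enclosure (width N l) (hz_set Z) (B i j Z)"
    using B Z unfolding sound_boxes_def by blast
  let ?R = "relu_hz G (B i j Z) Z"
  show L: "hz_lifts Z ?R" by (rule relu_hz_lifts[OF G I Z])
  have "hz_feasible ?R c b \<Longrightarrow> hz_feasible Z c b" for c b
    using L unfolding hz_lifts_def by blast
  then show "tracks N X t l ?R"
    unfolding tracks_def
    using relu_hz_carrier[OF G I Z] hz_lifts_trans[OF XZ L] relu_hz_point[OF G I Z] pt by simp
qed

lemma
  assumes "l < layers N"
  shows Wh_carrier: "Wh N (Suc l) \<in> carrier_mat (width N (Suc l)) (width N (Suc l))"
    and Wx_carrier: "Wx N (Suc l) \<in> carrier_mat (width N (Suc l)) (width N l)"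
    and vh_carrier: "vh N (Suc l) \<in> carrier_vec (width N (Suc l))"
  using N assms unfolding rnn_wf_def by (force dest: bspec[of _ _ "Suc l"])+

text \<open>The lifts between layers are carried along because the next pass forms constrained
  products with these sets.\<close>

lemma first_pass:
  assumes "l \<le> layers N"
  shows "tracks N X 1 l (H 1 l) \<and> (\<forall>k \<le> l. hz_lifts (H 1 k) (H 1 l))"
  using assms
proof (induction l)
  case 0
  show ?case using X N hz_lifts_refl[OF X] by (simp add: tracks_def rnn_wf_def)
next
  case (Suc l)
  then have l: "l < layers N" and IH: "tracks N X 1 l (H 1 l)" "\<forall>k \<le> l. hz_lifts (H 1 k) (H 1 l)"
    by simp_all
  note W = Wx_carrier[OF l] vh_carrier[OF l] and IH' = IH(1)[unfolded tracks_def]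
  let ?Z = "hz_affine (Wx N (Suc l)) (H 1 l) (vh N (Suc l))"
  have Z: "?Z \<in> hz_carrier (width N (Suc l))"
    using IH' W by (intro hz_affine_carrier) auto
  have pt: "relu (hz_point ?Z c b) = rnn_state N (hz_point X c b) 1 (Suc l)"
    if "hz_feasible ?Z c b" for c b
  proof -
    \<comment> \<open>The zero initial hidden state removes the recurrent term, which the algorithm
      omits at time 1.\<close>
    have "Wh N (Suc l) *\<^sub>v 0\<^sub>v (width N (Suc l)) = 0\<^sub>v (width N (Suc l))"
      using Wh_carrier[OF l] by (intro eq_vecI) auto
    moreover have "hz_point ?Z c b = Wx N (Suc l) *\<^sub>v hz_point (H 1 l) c b + vh N (Suc l)"
      by (rule hz_point_affine[OF conjunct1[OF IH'] W])
    moreover have "hz_point (H 1 l) c b = rnn_state N (hz_point X c b) 1 l"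
      using that IH' by simp
    ultimately show ?thesis
      using W by simp
  qed
  have XZ: "hz_lifts X ?Z" using IH' by simp
  have "H 1 (Suc l) = relu_hz G (B 1 (Suc l) ?Z) ?Z" by (simp add: Let_def)
  with tracks_relu[OF Z XZ pt, of 1 "Suc l"]
  have R: "tracks N X 1 (Suc l) (H 1 (Suc l))" "hz_lifts (H 1 l) (H 1 (Suc l))"
    by simp_all
  moreover have "hz_lifts (H 1 (Suc l)) (H 1 (Suc l))"
    using R(1) hz_lifts_refl unfolding tracks_def by blast
  ultimately show ?case
    using IH(2) hz_lifts_trans by (metis le_Suc_eq)
qed

text \<open>Each pass continues the chain of lifts at the last layer of the preceding one. A layer's
  previous set thus lifts through that last layer to the current set, as the constrained product
  requires.\<close>

lemma next_pass:
  assumes prev: "\<And>l. l \<le> layers N \<Longrightarrow>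
      tracks N X (Suc t) l (H (Suc t) l) \<and> hz_lifts (H (Suc t) l) (H (Suc t) (layers N))"
    and "l \<le> layers N"
  shows "tracks N X (Suc (Suc t)) l (H (Suc (Suc t)) l) \<and>
    (\<forall>k \<le> l. hz_lifts (H (Suc (Suc t)) k) (H (Suc (Suc t)) l)) \<and>
    hz_lifts (H (Suc t) (layers N)) (H (Suc (Suc t)) l)"
  using assms(2)
proof (induction l)
  case 0
  let ?Y = "H (Suc t) (layers N)" and ?R = "H (Suc (Suc t)) 0"
  let ?Z = "hz_affine (Wy N) ?Y (vy N)"
  have Y: "?Y \<in> hz_carrier (width N (layers N))" "hz_lifts X ?Y"
    "\<And>c b. hz_feasible ?Y c b \<Longrightarrow> hz_point ?Y c b = rnn_state N (hz_point X c b) (Suc t) (layers N)"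
    using prev[of "layers N"] by (auto simp: tracks_def)
  have W: "Wy N \<in> carrier_mat n (width N (layers N))" "vy N \<in> carrier_vec n" "width N 0 = n"
    using N by (auto simp: rnn_wf_def)
  have Z: "?Z \<in> hz_carrier (width N 0)"
    unfolding W(3) by (rule hz_affine_carrier[OF Y(1) W(1,2)])
  have pt: "relu (hz_point ?Z c b) = rnn_state N (hz_point X c b) (Suc (Suc t)) 0"
    if "hz_feasible ?Z c b" for c b
    using that Y(3) by (simp add: hz_point_affine[OF Y(1) W(1,2)])
  have XZ: "hz_lifts X ?Z" using Y(2) by simp
  have "?R = relu_hz G (B (Suc (Suc t)) 0 ?Z) ?Z" by (simp add: Let_def)
  with tracks_relu[OF Z XZ pt, of "Suc (Suc t)" 0]
  have R: "tracks N X (Suc (Suc t)) 0 ?R" "hz_lifts ?Y ?R"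
    by simp_all
  moreover have "hz_lifts ?R ?R"
    using R(1) hz_lifts_refl unfolding tracks_def by blast
  ultimately show ?case by simp
next
  case (Suc l)
  let ?t = "Suc (Suc t)"
  from Suc have l: "l < layers N"
    and IH: "tracks N X ?t l (H ?t l)" "\<forall>k \<le> l. hz_lifts (H ?t k) (H ?t l)"
      "hz_lifts (H (Suc t) (layers N)) (H ?t l)"
    by simp_all
  let ?U = "H (Suc t) (Suc l)" and ?V = "H ?t l" and ?R = "H ?t (Suc l)"
  let ?W = "Wh N (Suc l) @\<^sub>c Wx N (Suc l)"
  let ?Z = "hz_affine ?W (hz_cprod ?U ?V) (vh N (Suc l))"
  note V = IH(1)[unfolded tracks_def]
  have U: "?U \<in> hz_carrier (width N (Suc l))"
    "\<And>c b. hz_feasible ?U c b \<Longrightarrow> hz_point ?U c b = rnn_state N (hz_point X c b) (Suc t) (Suc l)"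
    using prev[of "Suc l"] l by (auto simp: tracks_def)
  have UV: "hz_lifts ?U ?V"
    using prev[of "Suc l"] l IH(3) hz_lifts_trans by (metis Suc_leI)
  note C = U(1) conjunct1[OF V] UV
  have W: "?W \<in> carrier_mat (width N (Suc l)) (width N (Suc l) + width N l)"
    using Wh_carrier[OF l] Wx_carrier[OF l] by simp
  have Z: "?Z \<in> hz_carrier (width N (Suc l))"
    by (rule hz_affine_carrier[OF hz_cprod_carrier[OF C] W vh_carrier[OF l]])
  have pt: "relu (hz_point ?Z c b) = rnn_state N (hz_point X c b) ?t (Suc l)"
    if "hz_feasible ?Z c b" for c b
  proof -
    \<comment> \<open>The same factors are feasible for \<open>?V\<close> and \<open>?U\<close>, so
      both hidden states belong to the same starting point.\<close>
    have v: "hz_feasible ?V c b" using that by (simp add: hz_feasible_cprod[OF C])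
    then have u: "hz_feasible ?U c b" using UV unfolding hz_lifts_def by blast
    have "hz_point ?Z c b = ?W *\<^sub>v (hz_point ?U c b @\<^sub>v hz_point ?V c b) + vh N (Suc l)"
      by (simp only: hz_point_affine[OF hz_cprod_carrier[OF C] W vh_carrier[OF l]] hz_point_cprod[OF C])
    also have "?W *\<^sub>v (hz_point ?U c b @\<^sub>v hz_point ?V c b) =
        Wh N (Suc l) *\<^sub>v hz_point ?U c b + Wx N (Suc l) *\<^sub>v hz_point ?V c b"
      by (rule append_cols_mult_vec[OF Wh_carrier[OF l] Wx_carrier[OF l]])
        (use dim_hz_point[OF C(1)] dim_hz_point[OF C(2)] in auto)
    finally show ?thesis using u v U(2) V by simp
  qed
  have XZ: "hz_lifts X ?Z"
    unfolding hz_lifts_affine_right hz_lifts_cprod_right[OF C] using V by blast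
  have "?R = relu_hz G (B ?t (Suc l) ?Z) ?Z" by (simp add: Let_def)
  with tracks_relu[OF Z XZ pt, of ?t "Suc l"]
  have R: "tracks N X ?t (Suc l) ?R" "hz_lifts ?V ?R"
    by (simp_all add: hz_lifts_cprod_iff[OF C] del: layer_hz.simps)
  moreover have "hz_lifts ?R ?R"
    using R(1) hz_lifts_refl unfolding tracks_def by blast
  ultimately show ?case
    using IH(2,3) hz_lifts_trans by (metis le_Suc_eq)
qed

text \<open>Induction over passes. Each step needs the claim for the whole preceding pass, hence the
  arbitrary \<open>l\<close>; the shift to \<open>Suc t\<close> reflects that the first pass has
  time 1.\<close>

lemma layer_hz_tracks:
  assumes "l \<le> layers N"
  shows "tracks N X (Suc t) l (H (Suc t) l) \<and> hz_lifts (H (Suc t) l) (H (Suc t) (layers N))"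
  using assms
proof (induction t arbitrary: l)
  case 0
  then show ?case using first_pass[of l] first_pass[of "layers N"] by simp
next
  case (Suc t)
  then show ?case using next_pass[of t l] next_pass[of t "layers N"] by blast
qed

text \<open>Feasible factors of the set at time \<open>t\<close> yield a point of \<open>X\<close>
  together with its state. Conversely, lifting the factors of a point of \<open>X\<close> preserves
  that point, so every starting point occurs.\<close>

lemma
  assumes "t \<ge> 1"
  shows state_pair_carrier: "state_pair_hz G B N X t \<in> hz_carrier (2 * n)"
    and hz_set_state_pair:
      "hz_set (state_pair_hz G B N X t) = {x @\<^sub>v rnn_state N x t 0 | x. x \<in> hz_set X}"
    and dim_rnn_state: "x \<in> hz_set X \<Longrightarrow> dim_vec (rnn_state N x t 0) = n"
proof -
  let ?Y = "H t 0"
  have Y: "?Y \<in> hz_carrier n" "hz_lifts X ?Y"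
    "\<And>c b. hz_feasible ?Y c b \<Longrightarrow> hz_point ?Y c b = rnn_state N (hz_point X c b) t 0"
    using layer_hz_tracks[of 0 "t - 1"] assms N by (auto simp: tracks_def rnn_wf_def)
  have S: "state_pair_hz G B N X t = hz_cprod X ?Y"
    by (simp add: state_pair_hz_def)
  note C = X Y(1,2)
  have P: "hz_cprod X ?Y \<in> hz_carrier (2 * n)"
    using hz_cprod_carrier[OF C] by (simp add: mult_2)
  then show "state_pair_hz G B N X t \<in> hz_carrier (2 * n)" by (simp add: S)
  have lift: "\<exists>c b. hz_feasible ?Y c b \<and> x = hz_point X c b" if x: "x \<in> hz_set X" for x
  proof -
    obtain c b where x: "hz_feasible X c b" "x = hz_point X c b"
      using x unfolding hz_set_eq[OF X] by auto
    obtain c' b' where "hz_feasible ?Y c' b'" "\<forall>i < dim_col (Gc X). c' i = c i"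
        "\<forall>i < dim_col (Gb X). b' i = b i"
      using Y(2) x(1) unfolding hz_lifts_def by blast
    \<comment> \<open>The lifted factors agree with the old ones on all generators of
      \<open>X\<close>, hence evaluate to the same point.\<close>
    with x(2) show ?thesis using hz_point_cong[of X c c' b b'] by auto
  qed
  have down: "hz_point X c b \<in> hz_set X" if "hz_feasible ?Y c b" for c b
    using that Y(2) unfolding hz_set_eq[OF X] hz_lifts_def by blast
  show "hz_set (state_pair_hz G B N X t) = {x @\<^sub>v rnn_state N x t 0 | x. x \<in> hz_set X}"
  proof (intro equalityI subsetI)
    fix p assume "p \<in> hz_set (state_pair_hz G B N X t)"
    then obtain c b where "hz_feasible ?Y c b" "p = hz_point X c b @\<^sub>v hz_point ?Y c b"
      unfolding S hz_set_eq[OF P] by (auto simp: hz_point_cprod[OF C] hz_feasible_cprod[OF C])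
    then show "p \<in> {x @\<^sub>v rnn_state N x t 0 | x. x \<in> hz_set X}"
      using down Y(3) by auto
  next
    fix p assume "p \<in> {x @\<^sub>v rnn_state N x t 0 | x. x \<in> hz_set X}"
    then obtain c b where "hz_feasible ?Y c b" "p = hz_point X c b @\<^sub>v rnn_state N (hz_point X c b) t 0"
      using lift by blast
    then have "hz_feasible (hz_cprod X ?Y) c b" "p = hz_point (hz_cprod X ?Y) c b"
      by (simp_all add: hz_point_cprod[OF C] hz_feasible_cprod[OF C] Y(3))
    then show "p \<in> hz_set (state_pair_hz G B N X t)"
      unfolding S hz_set_eq[OF P] by blast
  qed
  show "dim_vec (rnn_state N x t 0) = n" if "x \<in> hz_set X"
    using lift[OF that] Y(3) dim_hz_point[OF Y(1)] by metis
qed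

end

theorem theorem1:
  fixes n T :: nat and N :: rnn and X :: hz
    and G :: "real \<Rightarrow> real \<Rightarrow> hz"
    and B :: "nat \<Rightarrow> nat \<Rightarrow> hz \<Rightarrow> real vec \<times> real vec"
    and S :: "nat \<Rightarrow> hz"
  assumes "rnn_wf n N"
    and "X \<in> hz_carrier n"
    and "T > 1"
    and "relu_graph_hz G"
    and "sound_boxes B"
  defines "S \<equiv> state_pair_hz G B N X"
  shows
    "(\<forall>X1 \<in> hz_carrier n. hz_set X1 \<subseteq> hz_set X \<longrightarrow> (\<forall>t \<in> {2..T}.
        hz_linear (second_block n) (hz_inter (first_block n) (S t) X1) \<in> hz_carrier n \<and>
        forward_reach N t (hz_set X1) =
          hz_set (hz_linear (second_block n) (hz_inter (first_block n) (S t) X1)))) \<and>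
     (\<forall>Tg \<in> hz_carrier n. \<forall>t \<in> {2..T}.
        hz_linear (first_block n) (hz_inter (second_block n) (S t) Tg) \<in> hz_carrier n \<and>
        backward_reach N (hz_set X) t (hz_set Tg) =
          hz_set (hz_linear (first_block n) (hz_inter (second_block n) (S t) Tg)))"
proof (intro conjI ballI impI)
  have F: "first_block n \<in> carrier_mat n (2 * n)" and L: "second_block n \<in> carrier_mat n (2 * n)"
    by simp_all
  fix t assume "t \<in> {2..T}"
  then have "t \<ge> 1" by simp
  note S = state_pair_carrier[OF assms(1,2,4,5) this] hz_set_state_pair[OF assms(1,2,4,5) this]
  note dims = dim_rnn_state[OF assms(1,2,4,5) \<open>t \<ge> 1\<close>]
  \<comment> \<open>With \<open>dims\<close> this ensures that the block selectors cut each state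
    pair between its two components.\<close>
  have dX: "dim_vec x = n" if "x \<in> hz_set X" for x
    using that dim_hz_point[OF assms(2)] unfolding hz_set_eq[OF assms(2)] by auto
  {
    fix X1 assume X1: "X1 \<in> hz_carrier n" "hz_set X1 \<subseteq> hz_set X"
    note J = hz_inter_carrier[OF S(1) X1(1) F] hz_set_inter[OF S(1) X1(1) F]
    show "hz_linear (second_block n) (hz_inter (first_block n) (S t) X1) \<in> hz_carrier n"
      unfolding S_def by (rule hz_affine_carrier[OF J(1) L]) simp
    \<comment> \<open>Since \<open>X1\<close> lies in the domain, restricting the graph over
      \<open>X\<close> loses no starting point of \<open>X1\<close>.\<close>
    have "hz_set (hz_inter (first_block n) (S t) X1) = {x @\<^sub>v rnn_state N x t 0 | x. x \<in> hz_set X1}"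
      unfolding S_def J(2) S(2) using X1(2) dX dims by (force simp: first_block_append)
    then have "hz_set (hz_linear (second_block n) (hz_inter (first_block n) (S t) X1)) =
        (\<lambda>z. second_block n *\<^sub>v z) ` {x @\<^sub>v rnn_state N x t 0 | x. x \<in> hz_set X1}"
      unfolding S_def hz_set_linear[OF J(1) L] by simp
    also have "\<dots> = forward_reach N t (hz_set X1)"
      unfolding forward_reach_def using X1(2) dX dims
      by (force simp: second_block_append image_iff)
    finally show "forward_reach N t (hz_set X1) =
        hz_set (hz_linear (second_block n) (hz_inter (first_block n) (S t) X1))" ..
  }
  {
    fix Tg assume Tg: "Tg \<in> hz_carrier n"
    note J = hz_inter_carrier[OF S(1) Tg L] hz_set_inter[OF S(1) Tg L]
    show "hz_linear (first_block n) (hz_inter (second_block n) (S t) Tg) \<in> hz_carrier n"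
      unfolding S_def by (rule hz_affine_carrier[OF J(1) F]) simp
    \<comment> \<open>The restriction now acts on the final state, while the starting point still
      ranges over \<open>X\<close>.\<close>
    have "hz_set (hz_inter (second_block n) (S t) Tg) =
        {x @\<^sub>v rnn_state N x t 0 | x. x \<in> hz_set X \<and> rnn_state N x t 0 \<in> hz_set Tg}"
      unfolding S_def J(2) S(2) using dX dims by (force simp: second_block_append)
    then have "hz_set (hz_linear (first_block n) (hz_inter (second_block n) (S t) Tg)) =
        (\<lambda>z. first_block n *\<^sub>v z) `
          {x @\<^sub>v rnn_state N x t 0 | x. x \<in> hz_set X \<and> rnn_state N x t 0 \<in> hz_set Tg}"
      unfolding S_def hz_set_linear[OF J(1) F] by simp
    also have "\<dots> = backward_reach N (hz_set X) t (hz_set Tg)"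
      unfolding backward_reach_def using dX dims
      by (force simp: first_block_append image_iff)
    finally show "backward_reach N (hz_set X) t (hz_set Tg) =
        hz_set (hz_linear (first_block n) (hz_inter (second_block n) (S t) Tg))" ..
  }
qed

end
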